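(* Let $\varepsilon>0$ and let $C=\{c_1,\dots,c_M\}\subset\mathbb{R}^n$ be the prototype set produced by leader clustering with threshold $\varepsilon$ applied to a finite nonempty sequence of data points $z_1,\dots,z_N\in\mathbb{R}^n$. Then: (1) $C$ is an $\varepsilon$-covering of the data: $\min_{c\in C}\lVert z-c\rVert\le\varepsilon$ for every processed point $z\in\{z_1,\dots,z_N\}$. (2) $C$ is an $\varepsilon$-packing: $\lVert c-c'\rVert>\varepsilon$ for any two distinct $c,c'\in C$. (3) Consequently, let $x\in\mathbb{R}^n$ be a point assigned to its nearest prototype $c\in C$, with $\rho:=\lVert x-c\rVert\le\varepsilon$, and let $x'=x+\eta$ with $\eta\in\mathbb{R}^n$, $\lVert\eta\rVert\le\delta$. Then $$\delta<\frac{\varepsilon}{2}-\rho\quad\Longrightarrow\quad x'\text{ is still assigned to }c,$$ i.e. $c$ is the nearest prototype in $C$ to $x'$.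
   Context: $\lVert\cdot\rVert$ denotes the Euclidean norm on the feature space $\mathbb{R}^n$. Leader clustering with threshold $\varepsilon$: the data points are visited one at a time in some (arbitrary, e.g. random) order, starting from an empty prototype set. When a point $z$ is visited, a new prototype, located exactly at $z$, is created if the distance from $z$ to every existing prototype is strictly greater than $\varepsilon$ (in particular the first visited point becomes a prototype); otherwise $z$ is assigned to its nearest existing prototype and no prototype is created. Prototypes are never moved or removed after creation. $C$ is the set of prototypes after all points have been visited. Assignment: once $C$ is constructed, a point $y\in\mathbb{R}^n$ is assigned to the prototype in $C$ nearest to it in the norm $\lVert\cdot\rVert$. Interpretation: $x$ and $x'$ represent the same physical pixel observed at two dates, with $\eta$ being acquisition noise. *)

theory Defs
  imports "HOL-Analysis.Analysis" "HOL-Library.Multiset"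
begin

text \<open>
  One visit updates the set of existing prototypes. On the empty set the condition is vacuous,
  so the first visited point always becomes a prototype. When no prototype is created, the
  visited point is assigned to its nearest prototype; this leaves the prototype set unchanged
  and is not recorded in the state.
\<close>

definition leader_step :: "real \<Rightarrow> 'a::real_normed_vector \<Rightarrow> 'a set \<Rightarrow> 'a set" where
  "leader_step \<epsilon> z C = (if \<forall>c\<in>C. norm (z - c) > \<epsilon> then insert z C else C)"

text \<open>The list is the sequence of points in the order in which they are visited.\<close>

definition leader_prototypes :: "real \<Rightarrow> 'a::real_normed_vector list \<Rightarrow> 'a set" where
  "leader_prototypes \<epsilon> vs = fold (leader_step \<epsilon>) vs {}"

text \<open>
  A relation rather than a function, because several prototypes may be equally near to \<open>y\<close>;
  no tie-breaking rule is fixed.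
\<close>

definition nearest_prototype :: "'a::real_normed_vector set \<Rightarrow> 'a \<Rightarrow> 'a \<Rightarrow> bool" where
  "nearest_prototype C y c \<longleftrightarrow> is_arg_min (\<lambda>c'. norm (y - c')) (\<lambda>c'. c' \<in> C) c"

end

theory Submission
  imports Defs
begin

text \<open>
  Leader clustering computes a greedy maximal \<open>\<epsilon>\<close>-separated subset of the data: maximality
  gives the covering property and separation the packing property. A visited point
  either becomes a prototype, or is rejected precisely because some prototype lies within \<open>\<epsilon>\<close>
  of it; since prototypes are never removed, that witness survives to the end, which is the covering property. A prototype is
  created only when it is farther than \<open>\<epsilon>\<close> from all earlier ones, so separation is an invariant of
  the run, which is the packing property. Both are proved by induction on the visiting order, for
  an arbitrary initial prototype set, so that the induction hypothesis applies to the state after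
  the first visit.

  Stability of the assignment follows from the packing property. In an \<open>\<epsilon>\<close>-separated set the open
  balls of radius \<open>\<epsilon> / 2\<close> around the members are disjoint, and a point in such a ball is strictly
  closer to its centre than to every other member. A perturbation of size at most
  \<open>\<delta> < \<epsilon> / 2 - \<rho>\<close> cannot move a point out of the ball
  around \<open>c\<close> when it starts at distance \<open>\<rho>\<close> from \<open>c\<close>, so the nearest prototype
  is kept and is even unique.
\<close>

lemma leader_step_superset: "C \<subseteq> leader_step \<epsilon> z C"
  by (auto simp: leader_step_def)

lemma fold_leader_step_superset: "C \<subseteq> fold (leader_step \<epsilon>) vs C"
proof (induction vs arbitrary: C)
  case (Cons v vs)
  then show ?case
    using leader_step_superset by fastforce
qed simp

lemma finite_fold_leader_step: "finite C \<Longrightarrow> finite (fold (leader_step \<epsilon>) vs C)"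
  by (induction vs arbitrary: C) (auto simp: leader_step_def)

text \<open>
  A rejected point is close to an existing prototype by the failure of the creation test, and a
  new prototype is at distance \<open>0\<close> from itself, which is where \<open>\<epsilon> \<ge> 0\<close> enters.
\<close>

lemma leader_step_covers:
  assumes "\<epsilon> \<ge> 0"
  shows "\<exists>c\<in>leader_step \<epsilon> z C. norm (z - c) \<le> \<epsilon>"
  using assms by (auto simp: leader_step_def not_less)

lemma fold_leader_step_covers:
  assumes "\<epsilon> \<ge> 0" "z \<in> set vs"
  shows "\<exists>c\<in>fold (leader_step \<epsilon>) vs C. norm (z - c) \<le> \<epsilon>"
  using assms(2)
proof (induction vs arbitrary: C)
  case (Cons v vs)
  show ?case
  proof (cases "z = v")
    case True
    then show ?thesis
      using leader_step_covers[OF assms(1)] fold_leader_step_superset by fastforce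
  next
    case False
    then show ?thesis
      using Cons by simp
  qed
qed simp

lemma leader_step_separated:
  assumes "pairwise (\<lambda>c c'. norm (c - c') > \<epsilon>) C"
  shows "pairwise (\<lambda>c c'. norm (c - c') > \<epsilon>) (leader_step \<epsilon> z C)"
  using assms by (auto simp: leader_step_def pairwise_insert norm_minus_commute)

lemma fold_leader_step_separated:
  "pairwise (\<lambda>c c'. norm (c - c') > \<epsilon>) C \<Longrightarrow>
    pairwise (\<lambda>c c'. norm (c - c') > \<epsilon>) (fold (leader_step \<epsilon>) vs C)"
  by (induction vs arbitrary: C) (simp_all add: leader_step_separated)

text \<open>
  By the triangle inequality a second member at distance at most \<open>\<epsilon> / 2\<close> from \<open>y\<close> would lie
  within \<open>\<epsilon>\<close> of \<open>c\<close>, against the separation.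
\<close>

lemma separated_half_ball_strictly_closer:
  fixes C :: "'a::real_normed_vector set"
  assumes sep: "pairwise (\<lambda>c c'. norm (c - c') > \<epsilon>) C"
    and "c \<in> C" "c' \<in> C" "c' \<noteq> c" and near: "norm (y - c) < \<epsilon> / 2"
  shows "norm (y - c) < norm (y - c')"
proof -
  have "\<epsilon> < norm (c - c')"
    using sep assms(2-4) by (auto simp: pairwise_def)
  also have "\<dots> \<le> norm (y - c) + norm (y - c')"
    using norm_triangle_ineq4[of "y - c'" "y - c"] by (simp add: algebra_simps)
  finally show ?thesis
    using near by linarith
qed

lemma separated_half_ball_unique_nearest:
  assumes "pairwise (\<lambda>c c'. norm (c - c') > \<epsilon>) C" "c \<in> C" "norm (y - c) < \<epsilon> / 2"
  shows "nearest_prototype C y c' \<longleftrightarrow> c' = c"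
  using separated_half_ball_strictly_closer[OF assms(1,2) _ _ assms(3)] assms(2)
  unfolding nearest_prototype_def is_arg_min_def by (metis less_asym less_irrefl)

theorem proposition3:
  fixes \<epsilon> :: real
    and zs vs :: "(real ^ 'n) list"
    and C :: "(real ^ 'n) set"
  assumes "\<epsilon> > 0"
    and "zs \<noteq> []"
    and "mset vs = mset zs"
    and "C = leader_prototypes \<epsilon> vs"
  shows "(finite C \<and> C \<noteq> {} \<and> (\<forall>z\<in>set zs. (MIN c\<in>C. norm (z - c)) \<le> \<epsilon>)) \<and>
         (\<forall>c\<in>C. \<forall>c'\<in>C. c \<noteq> c' \<longrightarrow> norm (c - c') > \<epsilon>) \<and>
         (\<forall>x c x' \<eta> \<rho> \<delta>.
           nearest_prototype C x c \<and> \<rho> = norm (x - c) \<and> \<rho> \<le> \<epsilon> \<and>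
           x' = x + \<eta> \<and> norm \<eta> \<le> \<delta> \<longrightarrow>
           \<delta> < \<epsilon> / 2 - \<rho> \<longrightarrow>
           nearest_prototype C x' c \<and> (\<forall>c'. nearest_prototype C x' c' \<longrightarrow> c' = c))"
proof (intro conjI)
  have set_vs: "set vs = set zs"
    using assms(3) by (rule mset_eq_setD)
  have C: "C = fold (leader_step \<epsilon>) vs {}"
    using assms(4) by (simp add: leader_prototypes_def)
  have covers: "\<exists>c\<in>C. norm (z - c) \<le> \<epsilon>" if "z \<in> set zs" for z
    using fold_leader_step_covers[of \<epsilon> z vs "{}"] assms(1) that by (simp add: C set_vs)
  show fin: "finite C"
    by (simp add: C finite_fold_leader_step)
  show "C \<noteq> {}"
    using covers[of "hd zs"] assms(2) by auto
  show "\<forall>z\<in>set zs. (MIN c\<in>C. norm (z - c)) \<le> \<epsilon>"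
  proof
    fix z assume "z \<in> set zs"
    then obtain c where "c \<in> C" "norm (z - c) \<le> \<epsilon>"
      using covers by blast
    then show "(MIN c\<in>C. norm (z - c)) \<le> \<epsilon>"
      using fin by (intro order_trans[OF Min_le]) auto
  qed
  have sep: "pairwise (\<lambda>c c'. norm (c - c') > \<epsilon>) C"
    by (simp add: C fold_leader_step_separated)
  then show "\<forall>c\<in>C. \<forall>c'\<in>C. c \<noteq> c' \<longrightarrow> norm (c - c') > \<epsilon>"
    by (simp add: pairwise_def)
  show "\<forall>x c x' \<eta> \<rho> \<delta>.
           nearest_prototype C x c \<and> \<rho> = norm (x - c) \<and> \<rho> \<le> \<epsilon> \<and>
           x' = x + \<eta> \<and> norm \<eta> \<le> \<delta> \<longrightarrow>
           \<delta> < \<epsilon> / 2 - \<rho> \<longrightarrow>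
           nearest_prototype C x' c \<and> (\<forall>c'. nearest_prototype C x' c' \<longrightarrow> c' = c)"
  proof (intro allI impI, elim conjE)
    fix x c x' \<eta> :: "real ^ 'n" and \<rho> \<delta> :: real
    assume x: "nearest_prototype C x c" "\<rho> = norm (x - c)" "x' = x + \<eta>" "norm \<eta> \<le> \<delta>"
      and small: "\<delta> < \<epsilon> / 2 - \<rho>"
    have "c \<in> C"
      using x(1) by (simp add: nearest_prototype_def is_arg_min_def)
    moreover have "norm (x' - c) < \<epsilon> / 2"
      using norm_triangle_ineq[of "x - c" \<eta>] x(2-4) small by (simp add: algebra_simps)
    ultimately show "nearest_prototype C x' c \<and> (\<forall>c'. nearest_prototype C x' c' \<longrightarrow> c' = c)"
      by (simp add: separated_half_ball_unique_nearest[OF sep])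
  qed
qed

end
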